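(* Let $N(f)$ denote the number of distinct monomials appearing (with nonzero coefficient) in a polynomial $f$. (1) Let $m\ge 2$ and let $\eta$ be a primitive $m$-th root of unity. Call a real polynomial $f(x)$ in one variable special if $f(\eta x)=f(x)$ identically (equivalently, every monomial $x^a$ of $f$ has $m\mid a$), $f(1)=1$, all coefficients of $f$ are non-negative, and $f(0)=0$. Then the set of values of $N(f)$ over all special $f$ is exactly the set of all positive integers. (2) Let $r\ge 1$ be an integer and let $\eta$ be a primitive $(2r+1)$-th root of unity. Call a real polynomial $f(x,y)$ special if $f(\eta x,\eta^2 y)=f(x,y)$ identically (equivalently, every monomial $x^ay^b$ of $f$ satisfies $a+2b\equiv 0 \pmod{2r+1}$), $f(x,y)=1$ on the line $x+y=1$, all coefficients of $f$ are non-negative, and $f(0,0)=0$. Then the number $N(f)$ of terms of a special $f$ is either $r+2$ or an integer at least $2r+3$; moreover, each of the values $r+2$ and every integer $\ge 2r+3$ is attained by some special $f$.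
   Context: "Has non-negative coefficients" means all coefficients are $\ge 0$. *)

theory Defs
  imports Complex_Main "HOL-Computational_Algebra.Polynomial"
begin

definition primitive_root :: "nat \<Rightarrow> complex \<Rightarrow> bool" where
  "primitive_root m \<eta> \<longleftrightarrow> \<eta> ^ m = 1 \<and> (\<forall>k. 0 < k \<and> k < m \<longrightarrow> \<eta> ^ k \<noteq> 1)"

definition N1 :: "real poly \<Rightarrow> nat" where
  "N1 f = card {i. coeff f i \<noteq> 0}"

definition special1 :: "nat \<Rightarrow> complex \<Rightarrow> real poly \<Rightarrow> bool" where
  "special1 m \<eta> f \<longleftrightarrow>
     (\<forall>x::complex. poly (map_poly of_real f) (\<eta> * x) = poly (map_poly of_real f) x)
     \<and> poly f 1 = 1 \<and> (\<forall>i. coeff f i \<ge> 0) \<and> poly f 0 = 0"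

text \<open>Part (2): bivariate real polynomials, represented by a finitely supported
  coefficient function c, where c a b is the coefficient of x^a y^b.\<close>
definition supp2 :: "(nat \<Rightarrow> nat \<Rightarrow> real) \<Rightarrow> (nat \<times> nat) set" where
  "supp2 c = {(a, b). c a b \<noteq> 0}"

definition is_poly2 :: "(nat \<Rightarrow> nat \<Rightarrow> real) \<Rightarrow> bool" where
  "is_poly2 c \<longleftrightarrow> finite (supp2 c)"

definition eval2 :: "(nat \<Rightarrow> nat \<Rightarrow> real) \<Rightarrow> complex \<Rightarrow> complex \<Rightarrow> complex" where
  "eval2 c x y = (\<Sum>(a, b)\<in>supp2 c. of_real (c a b) * x ^ a * y ^ b)"

definition N2 :: "(nat \<Rightarrow> nat \<Rightarrow> real) \<Rightarrow> nat" where
  "N2 c = card (supp2 c)"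

definition special2 :: "nat \<Rightarrow> complex \<Rightarrow> (nat \<Rightarrow> nat \<Rightarrow> real) \<Rightarrow> bool" where
  "special2 r \<eta> c \<longleftrightarrow> is_poly2 c
     \<and> (\<forall>x y::complex. eval2 c (\<eta> * x) (\<eta>^2 * y) = eval2 c x y)
     \<and> (\<forall>x y::real. x + y = 1 \<longrightarrow> eval2 c (of_real x) (of_real y) = 1)
     \<and> (\<forall>a b. c a b \<ge> 0)
     \<and> eval2 c 0 0 = 0"

end

theory Submission
  imports Defs
begin

text \<open>Part (2). Put \<open>n = 2r + 1\<close> and let \<open>\<Phi> = p + q\<close>, where \<open>q = y\<^sup>n\<close> and \<open>p\<close> is the Lucas-type
polynomial of weight \<open>n\<close> for the weight \<open>a + 2b\<close> of \<open>x\<^sup>a y\<^sup>b\<close>; it is special with \<open>r + 2\<close> terms.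
If a special \<open>f\<close> has degree at least \<open>2n\<close>, the D'Angelo--Kos--Riehl bound \<open>d \<le> 2N - 3\<close> gives
\<open>N \<ge> 2r + 3\<close>. If the degree is smaller, only the weights \<open>n, 2n, 3n\<close> occur, which forces
\<open>f = 1 - (1 - p - q)(1 + h)\<close> with \<open>h\<close> of weight \<open>n\<close>: its weight parts are \<open>p - h\<close>, \<open>q + p h\<close>
and \<open>q h\<close>. The last one shows \<open>h \<ge> 0\<close>, and counting terms gives \<open>N \<ge> 2r + 3\<close> unless \<open>h = 0\<close>,
that is \<open>f = \<Phi>\<close>.

The bound \<open>d \<le> 2N - 3\<close> follows from counting sign changes. Write \<open>1 - f = (1 - x - y) \<Sum>\<^sub>k g\<^sub>k\<close> with
\<open>g\<^sub>k\<close> homogeneous, so that \<open>g\<^sub>0 = 1\<close> and \<open>g\<^sub>k = (x + y) g\<^sub>k\<^sub>-\<^sub>1 - f\<^sub>k\<close>. Let \<open>V\<close> be the largest number of sign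
changes in the coefficient sequence when signs are assigned freely to zero coefficients. Multiplying
a non-zero form by \<open>x + y\<close> does not increase \<open>V\<close>, and no \<open>g\<^sub>k\<close> with \<open>k < d\<close> vanishes because \<open>f\<close> has
non-negative coefficients; subtracting \<open>f\<^sub>k\<close> increases \<open>V\<close> by at most twice its number of terms. The
top part \<open>f\<^sub>d = (x + y) g\<^sub>d\<^sub>-\<^sub>1\<close> is non-negative with at least two terms, so \<open>V\<close> of it is at least its
number of zero coefficients.

To realize the other values, replace a monomial \<open>M\<close> of \<open>f\<close> by \<open>M \<Phi>\<close>: applied to the monomials of \<open>p\<close> in
turn this gives \<open>2r + 3, \<dots>, 3r + 3\<close> terms, and applied to the term of highest degree in \<open>x\<close> it
adds \<open>r + 1\<close> terms.\<close>

section \<open>Sign changes with free zeros\<close>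

text \<open>Both values of \<open>\<sigma>\<close> are allowed at a zero coefficient. The maximal
  variation is not defined as a number; the lemmas below compare the changes of compatible patterns
  instead.\<close>

definition sign_compat :: "nat \<Rightarrow> (nat \<Rightarrow> real) \<Rightarrow> (nat \<Rightarrow> bool) \<Rightarrow> bool" where
  "sign_compat k g \<sigma> \<longleftrightarrow> (\<forall>i\<le>k. if \<sigma> i then 0 \<le> g i else g i \<le> 0)"

definition changes :: "(nat \<Rightarrow> bool) \<Rightarrow> nat \<Rightarrow> nat" where
  "changes \<sigma> k = card {i. i < k \<and> \<sigma> i \<noteq> \<sigma> (Suc i)}"

lemma changes_0 [simp]: "changes \<sigma> 0 = 0"
  by (simp add: changes_def)

lemma changes_Suc [simp]:
  "changes \<sigma> (Suc k) = changes \<sigma> k + (if \<sigma> k \<noteq> \<sigma> (Suc k) then 1 else 0)"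
proof -
  have "{i. i < Suc k \<and> \<sigma> i \<noteq> \<sigma> (Suc i)} =
      (if \<sigma> k \<noteq> \<sigma> (Suc k) then insert k {i. i < k \<and> \<sigma> i \<noteq> \<sigma> (Suc i)}
       else {i. i < k \<and> \<sigma> i \<noteq> \<sigma> (Suc i)})"
    by (auto simp: less_Suc_eq)
  then show ?thesis
    by (simp add: changes_def)
qed

lemma changes_cong:
  "(\<And>i. i \<le> k \<Longrightarrow> \<sigma> i = \<tau> i) \<Longrightarrow> changes \<sigma> k = changes \<tau> k"
  unfolding changes_def by (intro arg_cong[where f = card]) auto

lemma coeff_times_1_plus_X:
  "coeff (G * [:1, 1:]) 0 = coeff G 0"
  "coeff (G * [:1, 1:]) (Suc i) = coeff G (Suc i) + coeff (G :: real poly) i"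
  by (simp_all add: mult_pCons_right)

text \<open>Each coefficient of the product is a sum of two neighbours in \<open>G\<close>, so a
  sign that contradicts the upper neighbour must match the lower one; \<open>\<tau>\<close> then has
  a change between the two.\<close>

lemma variation_times_1_plus_X:
  fixes G :: "real poly"
  assumes "G \<noteq> 0" and deg: "degree G \<le> k"
    and \<sigma>: "sign_compat (Suc k) (coeff (G * [:1, 1:])) \<sigma>"
  obtains \<tau> where "sign_compat k (coeff G) \<tau>" "changes \<sigma> (Suc k) \<le> changes \<tau> k"
proof -
  define w where "w = degree G"
  have gw: "coeff G w \<noteq> 0" and gz: "\<And>i. i > w \<Longrightarrow> coeff G i = 0"
    using assms(1) by (auto simp: w_def coeff_eq_0)
  \<comment> \<open>Zeros up to the degree \<open>w\<close> copy \<open>\<sigma>\<close>. Above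
    \<open>w\<close> the pattern is shifted by one, because the product has one more position and
    its coefficient at \<open>Suc w\<close> is the leading one of \<open>G\<close>.\<close>
  define \<tau> where "\<tau> i = (if coeff G i = 0 then (if i \<le> w then \<sigma> i else \<sigma> (Suc i))
      else coeff G i > 0)" for i
  have s0: "if \<sigma> 0 then 0 \<le> coeff G 0 else coeff G 0 \<le> 0"
    using \<sigma> coeff_times_1_plus_X(1) unfolding sign_compat_def by (metis le0)
  have sS: "if \<sigma> (Suc i) then 0 \<le> coeff G (Suc i) + coeff G i
      else coeff G (Suc i) + coeff G i \<le> 0" if "i \<le> k" for i
    using \<sigma> that coeff_times_1_plus_X(2)[of G i] unfolding sign_compat_def
    by (metis Suc_le_mono)
  have compat: "sign_compat k (coeff G) \<tau>"
    by (auto simp: sign_compat_def \<tau>_def)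
  \<comment> \<open>The extra summand strengthens the induction: a disagreement at \<open>i\<close>
    comes with a surplus change of \<open>\<tau>\<close>.\<close>
  have low: "changes \<sigma> i + (if \<tau> i \<noteq> \<sigma> i then 1 else 0) \<le> changes \<tau> i" if "i \<le> w" for i
    using that
  proof (induction i)
    case 0
    then show ?case using s0 by (auto simp: \<tau>_def split: if_splits)
  next
    case (Suc i)
    have IH: "changes \<sigma> i + (if \<tau> i \<noteq> \<sigma> i then 1 else 0) \<le> changes \<tau> i"
      using Suc by simp
    have "i \<le> k" using Suc.prems deg w_def by linarith
    note s = sS[OF this]
    \<comment> \<open>A disagreement at \<open>Suc i\<close> means that
      \<open>coeff G (Suc i)\<close> is nonzero with the wrong sign, so \<open>coeff G i\<close>
      must compensate for it.\<close>
    have "\<tau> i = \<sigma> (Suc i)" if "\<tau> (Suc i) \<noteq> \<sigma> (Suc i)"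
      using that s Suc.prems by (auto simp: \<tau>_def split: if_splits)
    then show ?case using IH by (auto split: if_splits)
  qed
  have "changes \<sigma> (Suc (w + j)) \<le> changes \<tau> (w + j)" if "w + j \<le> k" for j
    using that
  proof (induction j)
    case 0
    have "w \<le> k" using deg w_def by simp
    then have "\<tau> w = \<sigma> (Suc w)"
      using sS[of w] gw gz[of "Suc w"] by (auto simp: \<tau>_def split: if_splits)
    then show ?case using low[of w] by (auto split: if_splits)
  next
    case (Suc j)
    have "\<tau> (w + Suc j) = \<sigma> (Suc (w + Suc j))"
      by (simp add: \<tau>_def gz)
    moreover have "\<tau> (w + j) = \<sigma> (Suc (w + j))"
    proof (cases j)
      case 0
      then show ?thesis
        using sS[of w] gw gz[of "Suc w"] Suc.prems by (auto simp: \<tau>_def split: if_splits)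
    qed (simp add: \<tau>_def gz)
    ultimately show ?case using Suc by auto
  qed
  from this[of "k - w"] have "changes \<sigma> (Suc k) \<le> changes \<tau> k"
    using deg w_def by simp
  with compat show thesis by (rule that)
qed

text \<open>Altering one entry disturbs only the pairs on its two sides, whence the factor
  2.\<close>

lemma variation_change_coeffs:
  assumes \<sigma>: "sign_compat k g \<sigma>" and "finite A"
    and eq: "\<And>i. i \<le> k \<Longrightarrow> i \<notin> A \<Longrightarrow> g i = g' i"
  obtains \<tau> where "sign_compat k g' \<tau>" "changes \<sigma> k \<le> changes \<tau> k + 2 * card A"
proof -
  define \<tau> where "\<tau> i = (if i \<in> A then 0 \<le> g' i else \<sigma> i)" for i
  define T where "T = {i. i < k \<and> \<tau> i \<noteq> \<tau> (Suc i)}"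
  have "{i. i < k \<and> \<sigma> i \<noteq> \<sigma> (Suc i)} \<subseteq> T \<union> (A \<union> (\<lambda>i. i - 1) ` A)"
  proof
    fix i assume i: "i \<in> {i. i < k \<and> \<sigma> i \<noteq> \<sigma> (Suc i)}"
    show "i \<in> T \<union> (A \<union> (\<lambda>i. i - 1) ` A)"
    proof (cases "i \<in> A \<or> Suc i \<in> A")
      case True
      then show ?thesis by (metis UnCI diff_Suc_1 imageI)
    qed (use i in \<open>auto simp: T_def \<tau>_def\<close>)
  qed
  then have "changes \<sigma> k \<le> card (T \<union> (A \<union> (\<lambda>i. i - 1) ` A))"
    unfolding changes_def using assms(2) by (intro card_mono) (auto simp: T_def)
  also have "\<dots> \<le> card T + (card A + card ((\<lambda>i. i - 1) ` A))"
    by (meson card_Un_le le_trans add_le_mono order_refl)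
  also have "\<dots> \<le> card T + 2 * card A"
    using card_image_le[OF assms(2), of "\<lambda>i. i - 1"] by simp
  finally have "changes \<sigma> k \<le> changes \<tau> k + 2 * card A"
    by (simp add: changes_def T_def)
  moreover have "sign_compat k g' \<tau>"
    using \<sigma> eq by (auto simp: sign_compat_def \<tau>_def)
  ultimately show thesis using that by blast
qed

text \<open>After a positive entry every zero can take the sign opposite to its predecessor; the
  zeros before the first positive entry alternate backwards from it. An all-zero sequence would fall
  short by one, so \<open>u\<close> is required.\<close>

lemma variation_ge_zeros:
  assumes "\<And>i. i \<le> k \<Longrightarrow> 0 \<le> g i" and "u \<le> k" "0 < g u"
  obtains \<sigma> where "sign_compat k g \<sigma>" "card {i. i \<le> k \<and> g i = 0} \<le> changes \<sigma> k"
proof -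
  have "\<exists>\<sigma>. sign_compat k g \<sigma> \<and> card {i. i \<le> k \<and> g i = 0} \<le> changes \<sigma> k"
    using assms
  proof (induction k arbitrary: u)
    case 0
    then have "sign_compat 0 g (\<lambda>_. True)" "{i. i \<le> 0 \<and> g i = 0} = {}"
      by (auto simp: sign_compat_def)
    then show ?case by (metis card.empty le0)
  next
    case (Suc k)
    show ?case
    proof (cases "\<exists>u\<le>k. 0 < g u")
      case True
      then obtain \<sigma> where \<sigma>: "sign_compat k g \<sigma>" "card {i. i \<le> k \<and> g i = 0} \<le> changes \<sigma> k"
        using Suc.IH Suc.prems(1) by (meson le_SucI)
      define \<tau> where "\<tau> = \<sigma>(Suc k := (if g (Suc k) = 0 then \<not> \<sigma> k else True))"
      have "changes \<tau> k = changes \<sigma> k"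
        by (rule changes_cong) (simp add: \<tau>_def)
      moreover have "sign_compat (Suc k) g \<tau>"
        using \<sigma>(1) Suc.prems(1) by (auto simp: sign_compat_def \<tau>_def le_Suc_eq)
      moreover have "{i. i \<le> Suc k \<and> g i = 0} =
          (if g (Suc k) = 0 then insert (Suc k) {i. i \<le> k \<and> g i = 0} else {i. i \<le> k \<and> g i = 0})"
        by (auto simp: le_Suc_eq)
      ultimately have "sign_compat (Suc k) g \<tau> \<and>
          card {i. i \<le> Suc k \<and> g i = 0} \<le> changes \<tau> (Suc k)"
        using \<sigma>(2) by (auto simp: \<tau>_def)
      then show ?thesis by blast
    next
      case False
      then have z: "g i = 0" if "i \<le> k" for i
        using that Suc.prems(1)[of i] by force
      with Suc.prems have pos: "0 < g (Suc k)"
        by (metis le_Suc_eq order_less_irrefl)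
      define \<tau> where "\<tau> i = even (Suc k - i)" for i
      have "changes \<tau> j = j" if "j \<le> Suc k" for j
        using that by (induction j) (auto simp: \<tau>_def)
      from this[of "Suc k"] have "changes \<tau> (Suc k) = Suc k" by simp
      moreover have "sign_compat (Suc k) g \<tau>"
        using z pos by (auto simp: sign_compat_def \<tau>_def le_Suc_eq)
      moreover have "{i. i \<le> Suc k \<and> g i = 0} = {..k}"
        using z pos by (auto simp: le_Suc_eq)
      ultimately show ?thesis by (intro exI[of _ \<tau>]) simp
    qed
  qed
  with that show thesis by blast
qed

section \<open>The degree bound\<close>

definition hom_part :: "(nat \<Rightarrow> nat \<Rightarrow> real) \<Rightarrow> nat \<Rightarrow> real poly" where
  "hom_part c k = (\<Sum>a\<le>k. monom (c a (k - a)) a)"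

lemma coeff_hom_part: "coeff (hom_part c k) a = (if a \<le> k then c a (k - a) else 0)"
  by (simp add: hom_part_def coeff_sum coeff_monom if_distrib cong: if_cong)

lemma poly_hom_part: "poly (hom_part c k) z = (\<Sum>a\<le>k. c a (k - a) * z ^ a)"
  by (simp add: hom_part_def poly_sum poly_monom)

lemma degree_hom_part: "degree (hom_part c k) \<le> k"
  by (rule degree_le) (simp add: coeff_hom_part)

lemma poly_eqI_infinite:
  fixes p q :: "real poly"
  assumes "infinite S" "\<And>x. x \<in> S \<Longrightarrow> poly p x = poly q x"
  shows "p = q"
proof (rule ccontr)
  assume "p \<noteq> q"
  then have "finite {x. poly (p - q) x = 0}" by (intro poly_roots_finite) simp
  moreover have "S \<subseteq> {x. poly (p - q) x = 0}" using assms(2) by auto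
  ultimately show False using assms(1) finite_subset by blast
qed

lemma sum_supp2_hom:
  assumes "supp2 c \<subseteq> {(a, b). a + b \<le> D}"
  shows "(\<Sum>(a, b)\<in>supp2 c. c a b * x ^ a * y ^ b) =
    (\<Sum>k\<le>D. \<Sum>a\<le>k. c a (k - a) * x ^ a * y ^ (k - a))"
proof -
  have "finite ({..D} \<times> {..D})" by simp
  then have "finite {(a, b). a + b \<le> D}"
    by (rule rev_finite_subset) auto
  then have "(\<Sum>(a, b)\<in>supp2 c. c a b * x ^ a * y ^ b) =
      (\<Sum>(a, b)\<in>{(a, b). a + b \<le> D}. c a b * x ^ a * y ^ b)"
    using assms by (intro sum.mono_neutral_left) (auto simp: supp2_def)
  also have "\<dots> = (\<Sum>k\<le>D. \<Sum>a\<le>k. c a (k - a) * x ^ a * y ^ (k - a))"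
    by (rule sum.triangle_reindex_eq)
  finally show ?thesis .
qed

lemma card_supp2_hom:
  assumes "supp2 c \<subseteq> {(a, b). a + b \<le> D}"
  shows "card (supp2 c) = (\<Sum>k\<le>D. card {a. coeff (hom_part c k) a \<noteq> 0})"
proof -
  define T where "T k = (\<lambda>a. (a, k - a)) ` {a. coeff (hom_part c k) a \<noteq> 0}" for k
  have fin: "finite {a. coeff (hom_part c k) a \<noteq> 0}" for k
    by (rule finite_subset[of _ "{..k}"]) (auto simp: coeff_hom_part split: if_splits)
  have "supp2 c = (\<Union>k\<le>D. T k)"
  proof (intro equalityI subsetI)
    fix p assume p: "p \<in> supp2 c"
    then have "fst p + snd p \<le> D" using assms by auto
    moreover have "p \<in> T (fst p + snd p)"
      using p by (auto simp: T_def supp2_def coeff_hom_part intro!: image_eqI[of _ _ "fst p"])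
    ultimately show "p \<in> (\<Union>k\<le>D. T k)" by blast
  qed (auto simp: T_def supp2_def coeff_hom_part split: if_splits)
  also have "card \<dots> = (\<Sum>k\<le>D. card (T k))"
    by (rule card_UN_disjoint) (auto simp: T_def fin coeff_hom_part split: if_splits)
  also have "\<dots> = (\<Sum>k\<le>D. card {a. coeff (hom_part c k) a \<noteq> 0})"
    by (intro sum.cong refl) (auto simp: T_def intro!: card_image inj_onI)
  finally show ?thesis .
qed

text \<open>The parts \<open>g\<^sub>k\<close> of \<open>(1 - f) / (1 - x - y)\<close>, dehomogenized by \<open>y = 1\<close>.\<close>
fun remainder_part :: "(nat \<Rightarrow> nat \<Rightarrow> real) \<Rightarrow> nat \<Rightarrow> real poly" where
  "remainder_part c 0 = 1"
| "remainder_part c (Suc k) = remainder_part c k * [:1, 1:] - hom_part c (Suc k)"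

lemma degree_remainder_part: "degree (remainder_part c k) \<le> k"
proof (induction k)
  case (Suc k)
  have "degree (remainder_part c k * [:1, 1:]) \<le> Suc k"
    using degree_mult_le[of "remainder_part c k" "[:1, 1:]"] Suc by simp
  then show ?case using degree_hom_part[of c "Suc k"] by (simp add: degree_diff_le)
qed simp

text \<open>The recursion starts at a single coefficient, which has no changes; each step multiplies
  by \<open>1 + X\<close> at no cost and then pays twice for every term subtracted.\<close>

lemma changes_remainder_part:
  assumes "\<And>j. j < k \<Longrightarrow> remainder_part c j \<noteq> 0"
    and "sign_compat k (coeff (remainder_part c k)) \<sigma>"
  shows "changes \<sigma> k \<le> 2 * (\<Sum>j=1..k. card {a. coeff (hom_part c j) a \<noteq> 0})"
  using assms
proof (induction k arbitrary: \<sigma>)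
  case (Suc k)
  let ?A = "{a. coeff (hom_part c (Suc k)) a \<noteq> 0}"
  have "finite ?A"
    by (rule finite_subset[of _ "{..Suc k}"]) (auto simp: coeff_hom_part split: if_splits)
  then obtain \<tau> where \<tau>:
      "sign_compat (Suc k) (coeff (remainder_part c k * [:1, 1:])) \<tau>"
      "changes \<sigma> (Suc k) \<le> changes \<tau> (Suc k) + 2 * card ?A"
    by (rule variation_change_coeffs[OF Suc.prems(2),
          where g' = "coeff (remainder_part c k * [:1, 1:])"]) auto
  obtain \<rho> where \<rho>: "sign_compat k (coeff (remainder_part c k)) \<rho>"
      "changes \<tau> (Suc k) \<le> changes \<rho> k"
    by (rule variation_times_1_plus_X[OF _ degree_remainder_part \<tau>(1)]) (use Suc.prems(1) in auto)
  have "changes \<rho> k \<le> 2 * (\<Sum>j=1..k. card {a. coeff (hom_part c j) a \<noteq> 0})"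
    by (rule Suc.IH[OF _ \<rho>(1)]) (use Suc.prems(1) in auto)
  with \<tau>(2) \<rho>(2) show ?case by (simp del: changes_Suc)
qed simp

text \<open>Let \<open>N\<close> be the number of terms, \<open>D\<close> the degree and
  \<open>M D\<close> the number of terms of the top form. Its \<open>D + 1 - M D\<close> or more
  zeros are bounded by \<open>2 * (N - M D)\<close>, so \<open>D + 1 \<le> 2 * N - M D\<close>, and
  \<open>M D\<close> is at least 2.\<close>

lemma degree_bound:
  assumes fin: "finite (supp2 c)" and nn: "\<And>a b. 0 \<le> c a b" and c00: "c 0 0 = 0"
    and line: "\<And>x::real. (\<Sum>(a, b)\<in>supp2 c. c a b * x ^ a * (1 - x) ^ b) = 1"
    and ab: "(a, b) \<in> supp2 c"
  shows "a + b + 3 \<le> 2 * card (supp2 c)"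
proof -
  define D where "D = Max ((\<lambda>(a, b). a + b) ` supp2 c)"
  define M where "M k = card {a. coeff (hom_part c k) a \<noteq> 0}" for k
  let ?p = "hom_part c" and ?G = "remainder_part c"
  have sub: "supp2 c \<subseteq> {(a, b). a + b \<le> D}"
  proof
    fix p assume "p \<in> supp2 c"
    then have "(\<lambda>(a, b). a + b) p \<le> D"
      unfolding D_def using fin by (intro Max_ge) auto
    then show "p \<in> {(a, b). a + b \<le> D}" by auto
  qed
  have abD: "a + b \<le> D" using ab sub by auto
  have "D \<in> (\<lambda>(a, b). a + b) ` supp2 c"
    unfolding D_def using fin ab by (intro Max_in) auto
  then obtain a0 b0 where ab0: "c a0 b0 \<noteq> 0" "a0 + b0 = D" by (auto simp: supp2_def)
  have p0: "?p 0 = 0" by (rule poly_eqI) (auto simp: coeff_hom_part c00)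
  have "D \<noteq> 0" using ab0 c00 by (cases a0; cases b0) auto
  then obtain E where E: "D = Suc E" by (cases D) auto
  have pnn: "0 \<le> coeff (?p k) i" for k i by (simp add: coeff_hom_part nn)
  have ptop: "coeff (?p D) a0 > 0"
    using ab0 nn[of a0 b0] by (auto simp: coeff_hom_part)
  \<comment> \<open>The identity on the line is homogenized by powers of \<open>x + y\<close> and
    then dehomogenized with \<open>z = x / y\<close>; for \<open>z \<ge> 0\<close> the denominator
    \<open>1 + z\<close> is positive.\<close>
  have id: "(\<Sum>k\<le>D. ?p k * [:1, 1:] ^ (D - k)) = [:1, 1:] ^ D"
  proof (rule poly_eqI_infinite[of "{0::real..}"])
    fix z :: real assume "z \<in> {0..}"
    then have z: "1 + z > 0" by auto
    define x where "x = z / (1 + z)"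
    have y: "1 - x = 1 / (1 + z)" using z by (simp add: x_def field_simps)
    have "1 = (\<Sum>k\<le>D. \<Sum>a\<le>k. c a (k - a) * x ^ a * (1 - x) ^ (k - a))"
      using line[of x] sum_supp2_hom[OF sub, of x "1 - x"] by simp
    also have "\<dots> = (\<Sum>k\<le>D. poly (?p k) z / (1 + z) ^ k)"
      unfolding poly_hom_part sum_divide_distrib y unfolding x_def
    proof (intro sum.cong refl)
      fix k a :: nat assume "a \<in> {..k}"
      then have "(1 + z) ^ k = (1 + z) ^ a * (1 + z) ^ (k - a)"
        by (simp flip: power_add)
      then show "c a (k - a) * (z / (1 + z)) ^ a * (1 / (1 + z)) ^ (k - a) =
          c a (k - a) * z ^ a / (1 + z) ^ k"
        by (simp add: power_divide)
    qed
    finally have "(1 + z) ^ D = (\<Sum>k\<le>D. poly (?p k) z / (1 + z) ^ k) * (1 + z) ^ D"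
      by simp
    also have "\<dots> = (\<Sum>k\<le>D. poly (?p k) z * (1 + z) ^ (D - k))"
      unfolding sum_distrib_right using z
      by (intro sum.cong refl) (simp add: power_diff)
    finally show "poly (\<Sum>k\<le>D. ?p k * [:1, 1:] ^ (D - k)) z = poly ([:1, 1:] ^ D) z"
      by (simp add: poly_sum)
  qed (rule infinite_Ici)
  \<comment> \<open>The recursion peels one form after another off \<open>id\<close>;
    \<open>k = E\<close> leaves only the top form.\<close>
  have G: "?G k * [:1, 1:] ^ (D - k) = (\<Sum>j=Suc k..D. ?p j * [:1, 1:] ^ (D - j))" if "k \<le> D" for k
    using that
  proof (induction k)
    case 0
    have "{..D} = insert 0 {Suc 0..D}" by auto
    then show ?case using id p0 by simp
  next
    case (Suc k)
    have eq: "{Suc k..D} = insert (Suc k) {Suc (Suc k)..D}" using Suc.prems by auto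
    have "D - k = Suc (D - Suc k)" using Suc.prems by simp
    then have "?G k * [:1, 1:] ^ (D - k) = ?G k * [:1, 1:] * [:1, 1:] ^ (D - Suc k)"
      by (simp only: power_Suc mult.assoc)
    with Suc eq show ?case by (simp add: left_diff_distrib del: mult_pCons_right mult_pCons_left)
  qed
  \<comment> \<open>If \<open>?G k\<close> vanished, the remaining forms would sum to zero at
    \<open>z = 1\<close>; being non-negative, each would vanish there, even the top one.\<close>
  have Gne: "?G k \<noteq> 0" if "k < D" for k
  proof
    assume "?G k = 0"
    then have "0 = (\<Sum>j=Suc k..D. poly (?p j) 1 * 2 ^ (D - j))"
      using arg_cong[OF G[of k], of "\<lambda>q. poly q 1"] that by (simp add: poly_sum)
    moreover have "0 \<le> poly (?p j) 1" for j
      by (auto simp: poly_hom_part intro!: sum_nonneg nn)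
    ultimately have "poly (?p D) 1 = 0"
      using that by (subst (asm) eq_commute, subst (asm) sum_nonneg_eq_0_iff) auto
    then have "coeff (?p D) a0 = 0"
      using ab0 unfolding poly_hom_part
      by (subst (asm) sum_nonneg_eq_0_iff) (auto simp: nn coeff_hom_part)
    then show False using ptop by simp
  qed
  have pD: "?p D = ?G E * [:1, 1:]"
    using G[of E] E by simp
  obtain \<sigma> where \<sigma>: "sign_compat D (coeff (?p D)) \<sigma>"
      "card {i. i \<le> D \<and> coeff (?p D) i = 0} \<le> changes \<sigma> D"
    by (rule variation_ge_zeros[of D "coeff (?p D)" a0]) (use pnn ptop ab0 in auto)
  obtain \<tau> where \<tau>: "sign_compat E (coeff (?G E)) \<tau>" "changes \<sigma> (Suc E) \<le> changes \<tau> E"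
    by (rule variation_times_1_plus_X[of "?G E" E \<sigma>])
      (use \<sigma>(1) pD E Gne degree_remainder_part in auto)
  have "changes \<tau> E \<le> 2 * (\<Sum>j=1..E. M j)"
    unfolding M_def by (rule changes_remainder_part[OF _ \<tau>(1)]) (use Gne E in auto)
  moreover have "{..D} = {i. i \<le> D \<and> coeff (?p D) i = 0} \<union> {i. coeff (?p D) i \<noteq> 0}"
    by (auto simp: coeff_hom_part split: if_splits)
  then have "card {..D} \<le> card {i. i \<le> D \<and> coeff (?p D) i = 0} + M D"
    unfolding M_def by (metis card_Un_le)
  moreover have "card (supp2 c) = (\<Sum>j=1..E. M j) + M D"
  proof -
    have "{..D} = insert 0 (insert D {1..E})" using E by auto
    moreover have "M 0 = 0" by (simp add: M_def p0)
    ultimately show ?thesis using card_supp2_hom[OF sub] E by (simp add: M_def)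
  qed
  \<comment> \<open>A multiple of \<open>1 + X\<close> vanishes at -1, which a single nonzero
    monomial does not.\<close>
  moreover have "2 \<le> M D"
  proof (rule ccontr)
    assume "\<not> 2 \<le> M D"
    moreover have fA: "finite {i. coeff (?p D) i \<noteq> 0}"
      by (rule finite_subset[of _ "{..D}"]) (auto simp: coeff_hom_part split: if_splits)
    ultimately have one: "\<And>i. coeff (?p D) i \<noteq> 0 \<Longrightarrow> i = a0"
      using ptop card_le_Suc0_iff_eq[OF fA] unfolding M_def by (metis (mono_tags, lifting)
        less_2_cases_iff less_irrefl linorder_not_le mem_Collect_eq One_nat_def le_refl le0)
    have "?p D = monom (coeff (?p D) a0) a0"
      by (rule poly_eqI) (use one in \<open>auto simp: coeff_monom\<close>)
    then have "poly (?p D) (-1) \<noteq> 0"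
      using ptop by (metis poly_monom mult_eq_0_iff order_less_irrefl power_eq_0_iff
          neg_equal_0_iff_equal zero_neq_one)
    then show False by (simp add: pD)
  qed
  ultimately show ?thesis using \<sigma>(2) \<tau>(2) abD E by simp
qed

section \<open>The canonical polynomial and tensoring\<close>

text \<open>Lucas polynomials in \<open>u = y / x^2\<close>: the value at \<open>u\<close> is
  \<open>s^m + t^m\<close> for the roots \<open>s, t\<close> of \<open>l^2 = l + u\<close>.\<close>

fun lucas_poly :: "nat \<Rightarrow> real poly" where
  "lucas_poly 0 = [:2:]"
| "lucas_poly (Suc 0) = 1"
| "lucas_poly (Suc (Suc m)) = lucas_poly (Suc m) + [:0, 1:] * lucas_poly m"

lemma coeff_lucas_poly:
  "if 2 * k \<le> m then 0 < coeff (lucas_poly m) k else coeff (lucas_poly m) k = 0"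
proof (induction m arbitrary: k rule: lucas_poly.induct)
  case (3 m)
  show ?case
  proof (cases k)
    case (Suc j)
    then show ?thesis using "3.IH"(1)[of k] "3.IH"(2)[of j]
      by (auto split: if_splits intro: add_pos_pos add_nonneg_pos)
  qed (use "3.IH"(1)[of 0] in \<open>simp add: coeff_pCons\<close>)
qed (auto simp: coeff_pCons split: nat.splits)

text \<open>On the line these roots are \<open>1 / x\<close> and \<open>(x - 1) / x\<close>, so this
  is the Binet formula multiplied by \<open>x ^ m\<close>.\<close>

lemma lucas_poly_on_line:
  fixes x :: real
  assumes "x \<noteq> 0"
  shows "x ^ m * poly (lucas_poly m) ((1 - x) / x\<^sup>2) = 1 + (x - 1) ^ m"
proof (induction m rule: lucas_poly.induct)
  case (3 m)
  define u where "u = (1 - x) / x\<^sup>2"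
  have u: "x\<^sup>2 * u = 1 - x" using assms by (simp add: u_def)
  have "x ^ Suc (Suc m) * poly (lucas_poly (Suc (Suc m))) u =
      x * (x ^ Suc m * poly (lucas_poly (Suc m)) u) + (x\<^sup>2 * u) * (x ^ m * poly (lucas_poly m) u)"
    by (simp add: algebra_simps power2_eq_square)
  also have "\<dots> = x * (1 + (x - 1) ^ Suc m) + (1 - x) * (1 + (x - 1) ^ m)"
    unfolding u using "3.IH" by (simp only: u_def)
  also have "\<dots> = 1 + (x - 1) ^ Suc (Suc m)"
    by (simp add: algebra_simps)
  finally show ?case by (simp only: u_def)
qed auto

text \<open>A form of \<open>special2\<close> free of complex numbers, with invariance turned into
  divisibility of weights; \<open>special2_iff_inv_poly\<close> links the two.\<close>

definition inv_poly :: "nat \<Rightarrow> (nat \<Rightarrow> nat \<Rightarrow> real) \<Rightarrow> bool" where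
  "inv_poly r c \<longleftrightarrow> finite (supp2 c) \<and> (\<forall>a b. 0 \<le> c a b) \<and> c 0 0 = 0
     \<and> (\<forall>(a, b)\<in>supp2 c. 2 * r + 1 dvd a + 2 * b)
     \<and> (\<forall>x. (\<Sum>(a, b)\<in>supp2 c. c a b * x ^ a * (1 - x) ^ b) = 1)"

lemma poly_lucas_odd:
  "poly (lucas_poly (2 * r + 1)) u = (\<Sum>k\<le>r. coeff (lucas_poly (2 * r + 1)) k * u ^ k)"
proof -
  have "coeff (lucas_poly (2 * r + 1)) k = 0" if "k > r" for k
    using coeff_lucas_poly[of k "2 * r + 1"] that by (auto split: if_splits)
  then have "degree (lucas_poly (2 * r + 1)) \<le> r"
    by (intro degree_le) auto
  then show ?thesis
    unfolding poly_altdef by (intro sum.mono_neutral_left) (auto simp: coeff_eq_0)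
qed

lemma lucas_coeff_pos: "k \<le> r \<Longrightarrow> 0 < coeff (lucas_poly (2 * r + 1)) k"
  using coeff_lucas_poly[of k "2 * r + 1"] by (auto split: if_splits)

text \<open>D'Angelo's group-invariant polynomial: one minus the product of
  \<open>1 - \<eta>^j x - \<eta>^(2j) y\<close> over all \<open>j\<close> modulo
  \<open>2 * r + 1\<close>.\<close>

definition Phi :: "nat \<Rightarrow> nat \<Rightarrow> nat \<Rightarrow> real" where
  "Phi r a b = (if a + 2 * b = 2 * r + 1 then coeff (lucas_poly (2 * r + 1)) b
     else if a = 0 \<and> b = 2 * r + 1 then 1 else 0)"

definition W :: "nat \<Rightarrow> (nat \<times> nat) set" where
  "W r = (\<lambda>k. (2 * r + 1 - 2 * k, k)) ` {..r} \<union> {(0, 2 * r + 1)}"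

lemma mem_W: "(a, b) \<in> W r \<longleftrightarrow> a + 2 * b = 2 * r + 1 \<or> a = 0 \<and> b = 2 * r + 1"
proof -
  have "a + 2 * b = 2 * r + 1 \<longleftrightarrow> (a, b) = (2 * r + 1 - 2 * b, b) \<and> b \<le> r" by auto
  then show ?thesis by (auto simp: W_def)
qed

lemma finite_W: "finite (W r)"
  by (simp add: W_def)

lemma card_W: "card (W r) = r + 2"
proof -
  have "(0, 2 * r + 1) \<notin> (\<lambda>k. (2 * r + 1 - 2 * k, k)) ` {..r}" by auto
  moreover have "card ((\<lambda>k. (2 * r + 1 - 2 * k, k)) ` {..r}) = r + 1"
    by (subst card_image) (auto simp: inj_on_def)
  ultimately show ?thesis by (simp add: W_def)
qed

lemma Phi_pos: "(a, b) \<in> W r \<Longrightarrow> 0 < Phi r a b"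
  using lucas_coeff_pos by (auto simp: W_def Phi_def)

lemma Phi_eq_0: "(a, b) \<notin> W r \<Longrightarrow> Phi r a b = 0"
  by (auto simp: Phi_def mem_W)

lemma Phi_nonneg: "0 \<le> Phi r a b"
  using Phi_pos Phi_eq_0 by (metis less_eq_real_def)

lemma supp2_Phi: "supp2 (Phi r) = W r"
  using Phi_pos Phi_eq_0 by (fastforce simp: supp2_def)

lemma W_weight: "(a, b) \<in> W r \<Longrightarrow> a + 2 * b = 2 * r + 1 \<or> a + 2 * b = 2 * (2 * r + 1)"
  by (auto simp: W_def)

lemma W_dvd: "(a, b) \<in> W r \<Longrightarrow> 2 * r + 1 dvd a + 2 * b"
  using W_weight by (metis dvd_refl dvd_triv_right)

lemma Phi_on_line:
  "(\<Sum>(a, b)\<in>W r. Phi r a b * x ^ a * (1 - x) ^ b) = 1"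
proof -
  let ?n = "2 * r + 1"
  have "(\<Sum>(a, b)\<in>W r. Phi r a b * x ^ a * (1 - x) ^ b) =
      (\<Sum>(a, b)\<in>(\<lambda>k. (?n - 2 * k, k)) ` {..r}. Phi r a b * x ^ a * (1 - x) ^ b) + (1 - x) ^ ?n"
    unfolding W_def by (subst sum.union_disjoint) (auto simp: Phi_def)
  also have "(\<Sum>(a, b)\<in>(\<lambda>k. (?n - 2 * k, k)) ` {..r}. Phi r a b * x ^ a * (1 - x) ^ b) =
      (\<Sum>k\<le>r. coeff (lucas_poly ?n) k * x ^ (?n - 2 * k) * (1 - x) ^ k)"
    by (subst sum.reindex) (auto simp: inj_on_def Phi_def intro!: sum.cong)
  also have "\<dots> + (1 - x) ^ ?n = 1"
  \<comment> \<open>The substitution \<open>u = y / x^2\<close> breaks down at \<open>x = 0\<close>;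
    there every Lucas term contains a positive power of \<open>x\<close>, and only
    \<open>y ^ ?n = 1\<close> survives.\<close>
  proof (cases "x = 0")
    case True
    then show ?thesis by (auto simp: power_0_left intro!: sum.neutral)
  next
    case False
    have "(\<Sum>k\<le>r. coeff (lucas_poly ?n) k * x ^ (?n - 2 * k) * (1 - x) ^ k) =
        x ^ ?n * poly (lucas_poly ?n) ((1 - x) / x\<^sup>2)"
      unfolding poly_lucas_odd sum_distrib_left
    proof (intro sum.cong refl)
      fix k assume "k \<in> {..r}"
      then have "x ^ ?n = x ^ (?n - 2 * k) * (x\<^sup>2) ^ k"
        by (simp flip: power_add power_mult)
      then show "coeff (lucas_poly ?n) k * x ^ (?n - 2 * k) * (1 - x) ^ k =
          x ^ ?n * (coeff (lucas_poly ?n) k * ((1 - x) / x\<^sup>2) ^ k)"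
        using False by (simp add: power_divide)
    qed
    also have "\<dots> = 1 + (x - 1) ^ ?n" by (rule lucas_poly_on_line[OF False])
    also have "(x - 1) ^ ?n = - ((1 - x) ^ ?n)"
      using power_minus_odd[of ?n "1 - x"] by simp
    finally show ?thesis by simp
  qed
  finally show ?thesis .
qed

lemma inv_poly_Phi: "inv_poly r (Phi r)"
proof -
  have "Phi r 0 0 = 0" by (simp add: Phi_def)
  then show ?thesis
    unfolding inv_poly_def supp2_Phi using Phi_on_line finite_W Phi_nonneg W_dvd by blast
qed

text \<open>D'Angelo's partial tensor product at one monomial. The comparisons guard the truncated
  subtractions.\<close>

definition tensor :: "nat \<Rightarrow> nat \<Rightarrow> nat \<Rightarrow> (nat \<Rightarrow> nat \<Rightarrow> real) \<Rightarrow> nat \<Rightarrow> nat \<Rightarrow> real" where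
  "tensor r m l c a b = (if (a, b) = (m, l) then 0 else c a b) +
     (if m \<le> a \<and> l \<le> b then c m l * Phi r (a - m) (b - l) else 0)"

definition shiftW :: "nat \<Rightarrow> nat \<Rightarrow> nat \<Rightarrow> (nat \<times> nat) set" where
  "shiftW r m l = (\<lambda>(a, b). (m + a, l + b)) ` W r"

text \<open>Since \<open>Phi\<close> equals 1 on the line, values there do not change; weights add
  up, and non-negativity excludes cancellation, so the support is a plain union.\<close>

lemma inv_poly_tensor:
  assumes c: "inv_poly r c" and ml: "(m, l) \<in> supp2 c"
  shows "inv_poly r (tensor r m l c)"
    and "supp2 (tensor r m l c) = (supp2 c - {(m, l)}) \<union> shiftW r m l"
proof -
  have nn: "0 \<le> c a b" for a b using c by (simp add: inv_poly_def)
  have cml: "0 < c m l" using ml nn[of m l] by (auto simp: supp2_def)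
  define u where "u a b = (if (a, b) = (m, l) then 0 else c a b)" for a b
  define v where "v a b = (if m \<le> a \<and> l \<le> b then c m l * Phi r (a - m) (b - l) else 0)" for a b
  have t: "tensor r m l c a b = u a b + v a b" for a b
    by (simp add: tensor_def u_def v_def)
  have v0: "v a b \<noteq> 0 \<longleftrightarrow> (a, b) \<in> shiftW r m l" for a b
  proof -
    have "v a b \<noteq> 0 \<longleftrightarrow> m \<le> a \<and> l \<le> b \<and> (a - m, b - l) \<in> W r"
      using cml Phi_pos[of "a - m" "b - l" r] Phi_eq_0[of "a - m" "b - l" r] by (auto simp: v_def)
    also have "\<dots> \<longleftrightarrow> (a, b) \<in> shiftW r m l"
      by (force simp: shiftW_def image_iff)
    finally show ?thesis .
  qed
  have vnn: "0 \<le> v a b" for a b using cml Phi_nonneg by (simp add: v_def)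
  have unn: "0 \<le> u a b" for a b using nn by (simp add: u_def)
  show supp: "supp2 (tensor r m l c) = (supp2 c - {(m, l)}) \<union> shiftW r m l"
  proof -
    have "tensor r m l c a b \<noteq> 0 \<longleftrightarrow> u a b \<noteq> 0 \<or> v a b \<noteq> 0" for a b
      unfolding t using unn[of a b] vnn[of a b] by linarith
    then show ?thesis unfolding supp2_def v0 by (auto simp: u_def)
  qed
  let ?S = "supp2 c" and ?V = "shiftW r m l"
  have fin: "finite ?S" "finite ?V" using c by (simp_all add: inv_poly_def shiftW_def finite_W)
  have "(\<Sum>(a, b)\<in>supp2 (tensor r m l c). tensor r m l c a b * x ^ a * (1 - x) ^ b) = 1" for x
  proof -
    let ?e = "\<lambda>f. \<lambda>(a, b). f a b * x ^ a * (1 - x) ^ b :: real"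
    have "sum (?e (tensor r m l c)) (supp2 (tensor r m l c)) = sum (?e (tensor r m l c)) (?S \<union> ?V)"
    proof (rule sum.mono_neutral_left)
      show "\<forall>p\<in>?S \<union> ?V - supp2 (tensor r m l c). ?e (tensor r m l c) p = 0"
        by (auto simp: supp2_def)
    qed (use fin supp in auto)
    also have "\<dots> = sum (?e u) (?S \<union> ?V) + sum (?e v) (?S \<union> ?V)"
      by (simp only: sum.distrib[symmetric])
        (rule sum.cong, auto simp: t distrib_right)
    also have "sum (?e u) (?S \<union> ?V) = sum (?e u) (?S - {(m, l)})"
      using fin by (intro sum.mono_neutral_right) (auto simp: supp2_def u_def split: if_splits)
    also have "\<dots> = sum (?e c) (?S - {(m, l)})"
      by (intro sum.cong) (auto simp: u_def split: if_splits)
    also have "\<dots> = sum (?e c) ?S - ?e c (m, l)"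
      using fin ml by (simp add: sum_diff1)
    also have "sum (?e c) ?S = 1" using c by (auto simp: inv_poly_def)
    also have "sum (?e v) (?S \<union> ?V) = sum (?e v) ?V"
      using fin v0 by (intro sum.mono_neutral_right) auto
    also have "\<dots> = (\<Sum>(a, b)\<in>W r. c m l * x ^ m * (1 - x) ^ l * (Phi r a b * x ^ a * (1 - x) ^ b))"
      unfolding shiftW_def
      by (subst sum.reindex) (auto simp: inj_on_def power_add v_def intro!: sum.cong)
    also have "\<dots> = c m l * x ^ m * (1 - x) ^ l * (\<Sum>(a, b)\<in>W r. Phi r a b * x ^ a * (1 - x) ^ b)"
      by (simp add: sum_distrib_left case_prod_unfold)
    finally show ?thesis by (simp add: Phi_on_line)
  qed
  moreover have "2 * r + 1 dvd a + 2 * b" if "(a, b) \<in> supp2 (tensor r m l c)" for a b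
  proof -
    have dv: "2 * r + 1 dvd a + 2 * b" if "(a, b) \<in> supp2 c" for a b
      using c that unfolding inv_poly_def by blast
    from that consider "(a, b) \<in> supp2 c"
      | a' b' where "a = m + a'" "b = l + b'" "(a', b') \<in> W r"
      unfolding supp shiftW_def by auto
    then show ?thesis
    proof cases
      case 2
      have "2 * r + 1 dvd (m + 2 * l) + (a' + 2 * b')"
        by (intro dvd_add dv[OF ml] W_dvd[OF 2(3)])
      then show ?thesis by (simp add: 2 algebra_simps)
    qed (rule dv)
  qed
  moreover have "tensor r m l c 0 0 = 0"
    using c by (auto simp: inv_poly_def tensor_def Phi_def)
  moreover have "0 \<le> tensor r m l c a b" for a b
    unfolding t using unn vnn by (rule add_nonneg_nonneg)
  ultimately show "inv_poly r (tensor r m l c)"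
    unfolding inv_poly_def using fin by (auto simp: supp)
qed

section \<open>Invariant polynomials of low degree\<close>

text \<open>The part of weight \<open>j * (2 * r + 1)\<close> is a power of \<open>x\<close> times
  this polynomial in \<open>y / x^2\<close>. The guard keeps truncated subtraction from reading off
  coefficients of other weights.\<close>

definition weight_part :: "nat \<Rightarrow> (nat \<Rightarrow> nat \<Rightarrow> real) \<Rightarrow> nat \<Rightarrow> real poly" where
  "weight_part r c j = (\<Sum>b\<le>j * (2 * r + 1).
     monom (if 2 * b \<le> j * (2 * r + 1) then c (j * (2 * r + 1) - 2 * b) b else 0) b)"

lemma coeff_weight_part:
  "coeff (weight_part r c j) b =
     (if 2 * b \<le> j * (2 * r + 1) then c (j * (2 * r + 1) - 2 * b) b else 0)"
  by (simp add: weight_part_def coeff_sum)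

lemma sum_by_weight:
  fixes x :: real
  assumes fin: "finite (supp2 c)" and "x \<noteq> 0"
    and supp: "\<And>a b. (a, b) \<in> supp2 c \<Longrightarrow> \<exists>j\<in>J. a + 2 * b = j * (2 * r + 1)"
    and J: "finite J"
  shows "(\<Sum>(a, b)\<in>supp2 c. c a b * x ^ a * y ^ b) =
    (\<Sum>j\<in>J. x ^ (j * (2 * r + 1)) * poly (weight_part r c j) (y / x\<^sup>2))"
proof -
  let ?n = "2 * r + 1" and ?e = "\<lambda>(a, b). c a b * x ^ a * y ^ b"
  let ?g = "\<lambda>(a, b). (a + 2 * b) div ?n"
  have "sum ?e (supp2 c) = (\<Sum>j\<in>J. sum ?e {p \<in> supp2 c. ?g p = j})"
  proof (rule sum.group[symmetric, OF fin J], rule image_subsetI)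
    fix p assume "p \<in> supp2 c"
    then obtain j where "j \<in> J" "fst p + 2 * snd p = j * ?n" using supp by (cases p) auto
    then show "?g p \<in> J" by (simp add: case_prod_unfold del: mult_Suc_right)
  qed
  also have "\<dots> = (\<Sum>j\<in>J. x ^ (j * ?n) * poly (weight_part r c j) (y / x\<^sup>2))"
  proof (rule sum.cong[OF refl])
    fix j
    let ?B = "{b. 2 * b \<le> j * ?n \<and> c (j * ?n - 2 * b) b \<noteq> 0}"
    have "{p \<in> supp2 c. ?g p = j} = (\<lambda>b. (j * ?n - 2 * b, b)) ` ?B"
    proof (intro equalityI subsetI)
      fix p assume p: "p \<in> {p \<in> supp2 c. ?g p = j}"
      obtain a b where ab: "p = (a, b)" by (cases p)
      obtain i where "a + 2 * b = i * ?n" using supp p ab by blast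
      moreover from this have "i = j" using p ab by (simp del: mult_Suc_right)
      ultimately have "a + 2 * b = j * ?n" by simp
      then have "a = j * ?n - 2 * b" "2 * b \<le> j * ?n" by linarith+
      with p ab show "p \<in> (\<lambda>b. (j * ?n - 2 * b, b)) ` ?B"
        by (auto simp: supp2_def)
    next
      fix p assume "p \<in> (\<lambda>b. (j * ?n - 2 * b, b)) ` ?B"
      then obtain b where b: "b \<in> ?B" "p = (j * ?n - 2 * b, b)" by blast
      then have "?g p = j * ?n div ?n" by simp
      also have "\<dots> = j" by (rule nonzero_mult_div_cancel_right) simp
      finally show "p \<in> {p \<in> supp2 c. ?g p = j}" using b by (simp add: supp2_def)
    qed
    then have "sum ?e {p \<in> supp2 c. ?g p = j} = (\<Sum>b\<in>?B. c (j * ?n - 2 * b) b * x ^ (j * ?n - 2 * b) * y ^ b)"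
      by (simp add: sum.reindex inj_on_def)
    also have "\<dots> = (\<Sum>b\<in>?B. x ^ (j * ?n) * (c (j * ?n - 2 * b) b * (y / x\<^sup>2) ^ b))"
    proof (intro sum.cong refl)
      fix b assume "b \<in> ?B"
      then have "x ^ (j * ?n) = x ^ (j * ?n - 2 * b) * (x\<^sup>2) ^ b"
        by (simp flip: power_add power_mult)
      then show "c (j * ?n - 2 * b) b * x ^ (j * ?n - 2 * b) * y ^ b =
          x ^ (j * ?n) * (c (j * ?n - 2 * b) b * (y / x\<^sup>2) ^ b)"
        using \<open>x \<noteq> 0\<close> by (simp add: power_divide)
    qed
    also have "\<dots> = (\<Sum>b\<le>j * ?n. x ^ (j * ?n) *
        ((if 2 * b \<le> j * ?n then c (j * ?n - 2 * b) b else 0) * (y / x\<^sup>2) ^ b))"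
      by (intro sum.mono_neutral_cong_left) auto
    also have "\<dots> = x ^ (j * ?n) * poly (weight_part r c j) (y / x\<^sup>2)"
      by (simp add: weight_part_def poly_sum poly_monom sum_distrib_left)
    finally show "sum ?e {p \<in> supp2 c. ?g p = j} =
        x ^ (j * ?n) * poly (weight_part r c j) (y / x\<^sup>2)" .
  qed
  finally show ?thesis .
qed

text \<open>A weight is at most twice the degree, hence below \<open>4 * (2 * r + 1)\<close>; weight
  zero is excluded by \<open>c 0 0 = 0\<close>.\<close>

lemma low_degree_supp:
  assumes c: "inv_poly r c" and low: "\<And>a b. (a, b) \<in> supp2 c \<Longrightarrow> a + b < 2 * (2 * r + 1)"
    and ab: "(a, b) \<in> supp2 c"
  shows "\<exists>j\<in>{1, 2, 3}. a + 2 * b = j * (2 * r + 1)"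
proof -
  obtain j where j: "a + 2 * b = j * (2 * r + 1)"
    using c ab unfolding inv_poly_def by (auto elim!: dvdE simp: mult.commute)
  have "a + 2 * b \<noteq> 0" using c ab by (cases a; cases b) (auto simp: inv_poly_def supp2_def)
  then have "j \<noteq> 0" using j by auto
  have "j * (2 * r + 1) < 4 * (2 * r + 1)" using low[OF ab] j by linarith
  then have "j < 4" by (simp only: mult_less_cancel2)
  with j \<open>j \<noteq> 0\<close> show ?thesis by (intro bexI[of _ j]) auto
qed

text \<open>On the line \<open>x + y = 1\<close> the value \<open>u = y / x\<^sup>2 = \<alpha>\<^sup>2 - \<alpha>\<close> is taken at both \<open>x = 1/\<alpha>\<close> and
  \<open>x = 1/(1 - \<alpha>)\<close>. For \<open>\<alpha> > 1\<close> the odd powers \<open>x ^ n\<close> differ in sign, and the two equations determine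
  the weight parts 2 and 3 from part 1.\<close>
lemma low_degree_weight_parts:
  assumes c: "inv_poly r c" and low: "\<And>a b. (a, b) \<in> supp2 c \<Longrightarrow> a + b < 2 * (2 * r + 1)"
  defines "P \<equiv> lucas_poly (2 * r + 1)" and "Q \<equiv> monom 1 (2 * r + 1) :: real poly"
    and "H \<equiv> lucas_poly (2 * r + 1) - weight_part r c 1"
  shows "weight_part r c 2 = Q + P * H" and "weight_part r c 3 = Q * H"
proof -
  let ?n = "2 * r + 1" and ?F = "weight_part r c"
  \<comment> \<open>\<open>A\<close> and \<open>B\<close> are the defects in the two claimed
    identities; both are shown to vanish.\<close>
  define A where "A = ?F 2 - Q - P * H"
  define B where "B = ?F 3 - Q * H"
  have key: "poly A u + (1 / \<alpha>) ^ ?n * poly B u = 0" if "\<alpha> \<noteq> 0" "u = \<alpha>\<^sup>2 - \<alpha>" for \<alpha> u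
  proof -
    define x where "x = 1 / \<alpha>"
    define X where "X = x ^ ?n"
    have x: "x \<noteq> 0" "X \<noteq> 0" using that by (simp_all add: x_def X_def)
    have u: "(1 - x) / x\<^sup>2 = u"
      unfolding that(2) using that(1) by (simp add: x_def field_simps power2_eq_square)
    have "(\<Sum>(a, b)\<in>supp2 c. c a b * x ^ a * (1 - x) ^ b) =
        (\<Sum>j\<in>{1, 2, 3}. x ^ (j * ?n) * poly (?F j) ((1 - x) / x\<^sup>2))"
      by (rule sum_by_weight[OF _ x(1) low_degree_supp[OF c low]]) (use c in \<open>auto simp: inv_poly_def\<close>)
    moreover have "x ^ (j * ?n) = X ^ j" for j
      unfolding X_def by (metis mult.commute power_mult)
    ultimately have "(\<Sum>j\<in>{1, 2, 3}. X ^ j * poly (?F j) u) = 1"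
      using c by (simp only: inv_poly_def u)
    then have f: "X * poly (?F 1) u + X ^ 2 * poly (?F 2) u + X ^ 3 * poly (?F 3) u = 1"
      by simp
    have "X * poly P u = 1 + (x - 1) ^ ?n"
      using lucas_poly_on_line[OF x(1), of ?n] u by (simp add: X_def P_def)
    also have "(x - 1) ^ ?n = - ((1 - x) ^ ?n)"
      using power_minus_odd[of ?n "1 - x"] by simp
    also have "1 - x = x ^ 2 * u" using u x by (auto simp: field_simps)
    also have "(x ^ 2 * u) ^ ?n = X ^ 2 * poly Q u"
      by (simp add: X_def Q_def poly_monom power_mult_distrib power_mult[symmetric] mult.commute)
    finally have p: "X * poly P u = 1 - X ^ 2 * poly Q u" by simp
    \<comment> \<open>The combination is chosen so that \<open>f\<close> and \<open>p + q\<close>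
      appear, both equal to 1 on the line; the rest cancels because
      \<open>H = P - ?F 1\<close>.\<close>
    have "X ^ 2 * (poly A u + X * poly B u) =
        (X * poly (?F 1) u + X ^ 2 * poly (?F 2) u + X ^ 3 * poly (?F 3) u) - X * poly (?F 1) u
        - X ^ 2 * poly Q u - X * poly H u * (X * poly P u + X ^ 2 * poly Q u)"
      by (simp add: A_def B_def algebra_simps power2_eq_square power3_eq_cube)
    also have "\<dots> = 1 - X ^ 2 * poly Q u - X * poly P u"
    proof -
      have pq: "X * poly P u + X ^ 2 * poly Q u = 1" using p by simp
      have h: "poly H u = poly P u - poly (?F 1) u" by (simp add: H_def P_def)
      show ?thesis unfolding f pq h by (simp add: algebra_simps)
    qed
    also have "\<dots> = 0" using p by simp
    finally show ?thesis using x by (simp add: X_def x_def)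
  qed
  have AB: "poly A u = 0 \<and> poly B u = 0" if "u > 0" for u
  proof -
    define \<alpha> where "\<alpha> = (1 + sqrt (1 + 4 * u)) / 2"
    have s: "sqrt (1 + 4 * u) > 1" using that by simp
    have "\<alpha>\<^sup>2 - \<alpha> = ((sqrt (1 + 4 * u))\<^sup>2 - 1) / 4"
      by (simp add: \<alpha>_def field_simps power2_eq_square)
    also have "\<dots> = u" using that by simp
    finally have u: "u = \<alpha>\<^sup>2 - \<alpha>" by simp
    then have u': "u = (1 - \<alpha>)\<^sup>2 - (1 - \<alpha>)" by (simp add: power2_eq_square algebra_simps)
    have \<alpha>: "\<alpha> > 1" using s by (simp add: \<alpha>_def)
    then have "(1 / \<alpha>) ^ ?n > 0" by simp
    moreover have "(1 / (1 - \<alpha>)) ^ ?n < 0"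
      using \<alpha> by (subst power_less_zero_eq) (auto simp: field_simps)
    moreover have "poly A u + (1 / \<alpha>) ^ ?n * poly B u = 0" using key[OF _ u] \<alpha> by simp
    moreover have "poly A u + (1 / (1 - \<alpha>)) ^ ?n * poly B u = 0" using key[OF _ u'] \<alpha> by simp
    ultimately have "((1 / \<alpha>) ^ ?n - (1 / (1 - \<alpha>)) ^ ?n) * poly B u = 0"
        "(1 / \<alpha>) ^ ?n \<noteq> (1 / (1 - \<alpha>)) ^ ?n"
      unfolding left_diff_distrib by linarith+
    then have "poly B u = 0" by simp
    then show ?thesis using key[OF _ u] \<alpha> by simp
  qed
  have "A = 0" "B = 0"
    by (rule poly_eqI_infinite[of "{0<..}"]; use AB infinite_Ioi in auto)+
  then show "?F 2 = Q + P * H" "?F 3 = Q * H" by (simp_all add: A_def B_def)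
qed

text \<open>If \<open>H\<close> has \<open>t > 0\<close> terms, weight 1 keeps at least
  \<open>r + 1 - t\<close> terms, weight 2 has at least \<open>1 + r + t\<close>, and weight 3 has
  \<open>t\<close>: together at least \<open>2 * r + 2 + t\<close>.\<close>

lemma low_degree_card:
  assumes c: "inv_poly r c" and low: "\<And>a b. (a, b) \<in> supp2 c \<Longrightarrow> a + b < 2 * (2 * r + 1)"
  shows "card (supp2 c) = r + 2 \<or> 2 * r + 3 \<le> card (supp2 c)"
proof -
  let ?n = "2 * r + 1" and ?F = "weight_part r c"
  define P where "P = lucas_poly ?n"
  define H where "H = P - ?F 1"
  note F = low_degree_weight_parts[OF c low, folded P_def, folded H_def]
  have fin: "finite (supp2 c)" and nn: "\<And>a b. 0 \<le> c a b" using c by (auto simp: inv_poly_def)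
  have Ppos: "0 < coeff P k" if "k \<le> r" for k using lucas_coeff_pos that by (simp add: P_def)
  have P0: "coeff P k = 0" if "k > r" for k
    using coeff_lucas_poly[of k ?n] that by (auto simp: P_def split: if_splits)
  have Pnn: "0 \<le> coeff P k" for k using Ppos P0 by (metis less_eq_real_def linorder_not_le)
  have F1: "c (?n - 2 * b) b = coeff P b - coeff H b" if "b \<le> r" for b
    using that by (simp add: H_def coeff_weight_part)
  \<comment> \<open>As \<open>Q\<close> is a monomial, each coefficient of \<open>H\<close> is a
    coefficient of \<open>c\<close> or zero, hence non-negative.\<close>
  have F3: "coeff H b = coeff (?F 3) (?n + b)" for b
    using arg_cong[OF F(2), of "\<lambda>p. coeff p (?n + b)"] by (simp add: coeff_monom_mult)
  have Hnn: "0 \<le> coeff H b" for b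
    unfolding F3 by (simp add: coeff_weight_part nn)
  have H0: "coeff H b = 0" if "b > r" for b
    using that P0 by (simp add: H_def coeff_weight_part)
  have F3': "c (?n - 2 * b) (?n + b) = coeff H b" if "b \<le> r" for b
    using F3[of b] that by (simp add: coeff_weight_part algebra_simps)
  have F2: "c (2 * ?n - 2 * b) b = (if b = ?n then 1 else 0) + coeff (P * H) b" if "b \<le> ?n" for b
    using arg_cong[OF F(1), of "\<lambda>p. coeff p b"] that by (simp add: coeff_weight_part)
  have PHnn: "0 \<le> coeff (P * H) b" for b
    unfolding coeff_mult by (intro sum_nonneg mult_nonneg_nonneg Pnn Hnn)
  have PHpos: "0 < coeff (P * H) (k + i)" if "k \<le> r" "coeff H i \<noteq> 0" for k i
    unfolding coeff_mult
    using that Ppos[of k] Hnn[of i]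
    by (intro sum_pos2[of _ k]) (auto intro!: mult_pos_pos mult_nonneg_nonneg Pnn Hnn)
  show ?thesis
  proof (cases "H = 0")
    case True
    have "supp2 c = W r"
    proof (intro equalityI subsetI)
      fix p assume p: "p \<in> supp2 c"
      obtain a b where ab: "p = (a, b)" by (cases p)
      from low_degree_supp[OF c low] p ab obtain j where
        j: "j \<in> {1, 2, 3}" "a + 2 * b = j * ?n" by blast
      then have a: "a = j * ?n - 2 * b" "2 * b \<le> j * ?n" by linarith+
      then have ne: "coeff (?F j) b \<noteq> 0"
        using p ab by (auto simp: coeff_weight_part supp2_def)
      from j(1) consider "j = 1" | "j = 2" | "j = 3" by blast
      then show "p \<in> W r"
      proof cases
        case 1
        then show ?thesis using a ab by (auto simp: W_def)
      next
        case 2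
        then have "b = ?n" using ne True F by (auto split: if_splits)
        then show ?thesis using a ab 2 by (auto simp: W_def)
      next
        case 3
        then show ?thesis using ne True F by auto
      qed
    next
      fix p assume "p \<in> W r"
      then show "p \<in> supp2 c"
        using F1 F2[of ?n] Ppos True by (fastforce simp: W_def supp2_def)
    qed
    then show ?thesis by (simp add: card_W)
  next
    case False
    define A where "A = {b. coeff H b \<noteq> 0}"
    have A1: "A \<subseteq> {..r}" using H0 by (auto simp: A_def not_less[symmetric])
    then have A: "A \<subseteq> {..r}" "finite A" "A \<noteq> {}"
      using False finite_subset by (auto simp: A_def poly_eq_iff)
    define m where "m = Min A"
    have m: "m \<in> A" "\<And>b. b \<in> A \<Longrightarrow> m \<le> b" using A by (auto simp: m_def)
    have "m \<le> r" using m A by auto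
    \<comment> \<open>All sums \<open>k + i\<close> with \<open>k \<le> r\<close> and
      \<open>i \<in> A\<close> are exponents of \<open>P * H\<close>. \<open>B\<close> selects
      \<open>card A + r\<close> of them: those with \<open>k = r\<close>, and the
      \<open>k + m\<close> lying below \<open>r + m\<close>.\<close>
    define B where "B = (\<lambda>b. r + b) ` A \<union> (\<lambda>k. k + m) ` {..<r}"
    have "card B = card A + r"
    proof -
      have "card B = card ((\<lambda>b. r + b) ` A) + card ((\<lambda>k. k + m) ` {..<r})"
        unfolding B_def using A m(2) by (intro card_Un_disjoint) (fastforce)+
      then show ?thesis by (simp add: card_image)
    qed
    have Bsub: "b \<le> 2 * r" if "b \<in> B" for b
      using that A \<open>m \<le> r\<close> by (auto simp: B_def)
    have Bpos: "0 < coeff (P * H) b" if "b \<in> B" for b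
      using that PHpos m(1) unfolding B_def A_def by auto
    define S1 where "S1 = (\<lambda>b. (?n - 2 * b, b)) ` ({..r} - A)"
    define S2 where "S2 = (\<lambda>b. (2 * ?n - 2 * b, b)) ` insert ?n B"
    define S3 where "S3 = (\<lambda>b. (?n - 2 * b, ?n + b)) ` A"
    have S: "S1 \<union> S2 \<union> S3 \<subseteq> supp2 c"
    proof -
      have "S1 \<subseteq> supp2 c"
        using F1 Ppos by (force simp: S1_def A_def supp2_def)
      moreover have "S2 \<subseteq> supp2 c"
      proof
        fix p assume "p \<in> S2"
        then obtain b where b: "b = ?n \<or> b \<in> B" "p = (2 * ?n - 2 * b, b)"
          by (auto simp: S2_def)
        have "b \<le> ?n" using b Bsub by fastforce
        with F2[OF this] b Bpos[of b] PHnn[of b] have "c (2 * ?n - 2 * b) b > 0"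
          by (auto split: if_splits)
        then show "p \<in> supp2 c" using b by (simp add: supp2_def)
      qed
      moreover have "S3 \<subseteq> supp2 c"
        using F3' A(1) by (force simp: S3_def A_def supp2_def)
      ultimately show ?thesis by blast
    qed
    have weights: "(\<lambda>(a, b). a + 2 * b) ` S1 \<subseteq> {?n}" "(\<lambda>(a, b). a + 2 * b) ` S2 \<subseteq> {2 * ?n}"
      "(\<lambda>(a, b). a + 2 * b) ` S3 \<subseteq> {3 * ?n}"
      using A(1) Bsub by (fastforce simp: S1_def S2_def S3_def)+
    have "S1 \<inter> S2 = {}" "(S1 \<union> S2) \<inter> S3 = {}"
      using weights by (auto simp: image_subset_iff) fastforce+
    moreover have f: "finite S1" "finite S2" "finite S3"
      using A(2) by (simp_all add: S1_def S2_def S3_def B_def)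
    moreover have "card S1 = r + 1 - card A"
      unfolding S1_def using A by (subst card_image) (auto simp: inj_on_def card_Diff_subset)
    moreover have "card S2 = 1 + card B"
    proof -
      have "?n \<notin> B" using Bsub by fastforce
      moreover have "finite B" using A by (simp add: B_def)
      ultimately show ?thesis unfolding S2_def by (subst card_image) (auto simp: inj_on_def)
    qed
    moreover have "card S3 = card A"
      unfolding S3_def by (subst card_image) (auto simp: inj_on_def)
    moreover have "card A \<le> r + 1" using card_mono[OF _ A(1)] by simp
    ultimately have "card (S1 \<union> S2 \<union> S3) = 2 * r + 2 + card A"
      using \<open>card B = card A + r\<close> by (simp add: card_Un_disjoint)
    moreover have "card A \<ge> 1" using A by (simp add: Suc_le_eq card_gt_0_iff)
    ultimately show ?thesis using card_mono[OF fin S] by linarith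
  qed
qed

lemma card_supp2_dichotomy:
  assumes c: "inv_poly r c"
  shows "card (supp2 c) = r + 2 \<or> 2 * r + 3 \<le> card (supp2 c)"
proof (cases "\<exists>(a, b)\<in>supp2 c. 2 * (2 * r + 1) \<le> a + b")
  case True
  then obtain a b where ab: "(a, b) \<in> supp2 c" "2 * (2 * r + 1) \<le> a + b" by auto
  have "a + b + 3 \<le> 2 * card (supp2 c)"
    by (rule degree_bound[OF _ _ _ _ ab(1)]) (use c in \<open>auto simp: inv_poly_def\<close>)
  \<comment> \<open>Here \<open>4 * r + 5 \<le> 2 * card (supp2 c)\<close>, and parity gains the
    last half.\<close>
  with ab(2) show ?thesis by presburger
next
  case False
  then show ?thesis by (intro low_degree_card[OF c]) force
qed

section \<open>Realizing term counts\<close>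

text \<open>Coefficients can be forgotten: the support after tensoring depends only on the support
  before.\<close>

definition realizable :: "nat \<Rightarrow> (nat \<times> nat) set \<Rightarrow> bool" where
  "realizable r S \<longleftrightarrow> (\<exists>c. inv_poly r c \<and> supp2 c = S)"

lemma realizable_W: "realizable r (W r)"
  unfolding realizable_def using inv_poly_Phi supp2_Phi by blast

lemma realizable_tensor:
  "realizable r S \<Longrightarrow> (m, l) \<in> S \<Longrightarrow> realizable r ((S - {(m, l)}) \<union> shiftW r m l)"
  unfolding realizable_def using inv_poly_tensor by metis

definition dominant :: "(nat \<times> nat) set \<Rightarrow> nat \<Rightarrow> bool" where
  "dominant S M \<longleftrightarrow> (M, 0) \<in> S \<and> (\<forall>(a, b)\<in>S. (a, b) = (M, 0) \<or> a < M)"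

lemma mem_shiftW:
  "(a, b) \<in> shiftW r m l \<longleftrightarrow>
     m \<le> a \<and> l \<le> b \<and> a + 2 * b = 2 * r + 1 + m + 2 * l \<or> a = m \<and> b = l + 2 * r + 1"
proof -
  have "(a, b) \<in> shiftW r m l \<longleftrightarrow> m \<le> a \<and> l \<le> b \<and> (a - m, b - l) \<in> W r"
    by (force simp: shiftW_def image_iff)
  also have "\<dots> \<longleftrightarrow>
     m \<le> a \<and> l \<le> b \<and> a + 2 * b = 2 * r + 1 + m + 2 * l \<or> a = m \<and> b = l + 2 * r + 1"
    unfolding mem_W by auto
  finally show ?thesis .
qed

lemma finite_shiftW: "finite (shiftW r m l)"
  by (simp add: shiftW_def finite_W)

lemma card_shiftW: "card (shiftW r m l) = r + 2"
  unfolding shiftW_def by (subst card_image) (auto simp: inj_on_def card_W)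

text \<open>The new monomials have \<open>x\<close>-exponent at least \<open>M\<close> and the old
  ones less, so nothing collides; one monomial gives way to \<open>r + 2\<close>.\<close>

lemma tensor_dominant:
  assumes "finite S" and S: "dominant S M"
  shows "card ((S - {(M, 0)}) \<union> shiftW r M 0) = card S + r + 1"
    and "dominant ((S - {(M, 0)}) \<union> shiftW r M 0) (M + (2 * r + 1))"
proof -
  define S' where "S' = (S - {(M, 0)}) \<union> shiftW r M 0"
  have "p \<notin> shiftW r M 0" if "p \<in> S - {(M, 0)}" for p
  proof -
    obtain a b where ab: "p = (a, b)" by (cases p)
    then have "a < M" using S that unfolding dominant_def by blast
    then show ?thesis by (simp add: ab mem_shiftW)
  qed
  then have "(S - {(M, 0)}) \<inter> shiftW r M 0 = {}" by blast
  then have "card S' = card (S - {(M, 0)}) + (r + 2)"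
    using assms(1) finite_shiftW by (simp add: S'_def card_Un_disjoint card_shiftW)
  moreover have "card S = Suc (card (S - {(M, 0)}))"
    using S assms(1) by (intro card.remove) (auto simp: dominant_def)
  ultimately show "card ((S - {(M, 0)}) \<union> shiftW r M 0) = card S + r + 1"
    by (simp add: S'_def)
  show "dominant ((S - {(M, 0)}) \<union> shiftW r M 0) (M + (2 * r + 1))"
    unfolding dominant_def
  proof (intro conjI ballI)
    show "(M + (2 * r + 1), 0) \<in> (S - {(M, 0)}) \<union> shiftW r M 0"
      by (simp add: mem_shiftW)
    fix p assume p: "p \<in> (S - {(M, 0)}) \<union> shiftW r M 0"
    obtain a b where ab: "p = (a, b)" by (cases p)
    have "a < M" if "(a, b) \<in> S - {(M, 0)}"
      using S that unfolding dominant_def by blast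
    then consider "a < M" | "(a, b) \<in> shiftW r M 0"
      using p unfolding ab by blast
    then show "case p of (a, b) \<Rightarrow> (a, b) = (M + (2 * r + 1), 0) \<or> a < M + (2 * r + 1)"
      by cases (auto simp: ab mem_shiftW)
  qed
qed

text \<open>For \<open>1 \<le> j\<close>, the support after tensoring at the monomials \<open>(2r + 1 - 2k, k)\<close> with \<open>k < j\<close>
  in turn, starting from \<open>\<Phi>\<close>.\<close>
definition stair :: "nat \<Rightarrow> nat \<Rightarrow> (nat \<times> nat) set" where
  "stair r j = (\<lambda>k. (2 * r + 1 - 2 * k, k)) ` {j..r} \<union>
     (\<lambda>i. (2 * (2 * r + 1) - 2 * i, i)) ` insert (2 * r + 1) {..<j + r} \<union>
     (\<lambda>i. (2 * r + 1 - 2 * i, 2 * r + 1 + i)) ` {..<j}"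

text \<open>Sorting by weight makes membership linear arithmetic; the bound on \<open>j\<close>
  keeps the subtractions in \<open>stair\<close> from truncating.\<close>

lemma mem_stair:
  assumes "j \<le> r + 1"
  shows "(a, b) \<in> stair r j \<longleftrightarrow> a + 2 * b = 2 * r + 1 \<and> j \<le> b \<or>
    a + 2 * b = 2 * (2 * r + 1) \<and> (b < j + r \<or> b = 2 * r + 1) \<or>
    a + 2 * b = 3 * (2 * r + 1) \<and> 2 * r + 1 \<le> b \<and> b < 2 * r + 1 + j"
proof -
  let ?n = "2 * r + 1"
  have "(a, b) \<in> (\<lambda>k. (?n - 2 * k, k)) ` {j..r} \<longleftrightarrow> a + 2 * b = ?n \<and> j \<le> b"
    unfolding image_iff by auto
  moreover have "(a, b) \<in> (\<lambda>i. (2 * ?n - 2 * i, i)) ` insert ?n {..<j + r} \<longleftrightarrow>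
      a + 2 * b = 2 * ?n \<and> (b < j + r \<or> b = ?n)"
    unfolding image_iff using assms by auto
  moreover have "(a, b) \<in> (\<lambda>i. (?n - 2 * i, ?n + i)) ` {..<j} \<longleftrightarrow>
      a + 2 * b = 3 * ?n \<and> ?n \<le> b \<and> b < ?n + j" (is "?L \<longleftrightarrow> ?R")
  proof
    assume ?R
    then show ?L by (intro image_eqI[of _ _ "b - ?n"]) auto
  qed (use assms in auto)
  ultimately show ?thesis unfolding stair_def by blast
qed

lemma stair_1: "stair r 1 = (W r - {(2 * r + 1, 0)}) \<union> shiftW r (2 * r + 1) 0"
proof -
  have "(a, b) \<in> stair r 1 \<longleftrightarrow> (a, b) \<in> (W r - {(2 * r + 1, 0)}) \<union> shiftW r (2 * r + 1) 0"
    for a b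
    by (auto simp: mem_stair mem_W mem_shiftW)
  then show ?thesis by (simp add: set_eq_iff)
qed

text \<open>In weight 2 the shifted \<open>Phi\<close> overlaps the stair except at
  \<open>b = j + r\<close>, and its shifted power of \<open>y\<close> adds one monomial of weight 3.
  Two enter and one leaves.\<close>

lemma stair_Suc:
  assumes "1 \<le> j" "j \<le> r"
  shows "stair r (Suc j) = (stair r j - {(2 * r + 1 - 2 * j, j)}) \<union> shiftW r (2 * r + 1 - 2 * j) j"
proof -
  obtain m where m: "2 * r + 1 - 2 * j = m" "m + 2 * j = 2 * r + 1" using assms by simp
  have j: "Suc j \<le> r + 1" "j \<le> r + 1" using assms by auto
  have "(a, b) \<in> stair r (Suc j) \<longleftrightarrow> (a, b) \<in> (stair r j - {(m, j)}) \<union> shiftW r m j" for a b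
  proof -
    let ?n = "2 * r + 1"
    have "a + 2 * b = ?n \<and> Suc j \<le> b \<longleftrightarrow> (a + 2 * b = ?n \<and> j \<le> b) \<and> \<not> (a = m \<and> b = j)"
      using m(2) by linarith
    moreover have "a + 2 * b = 2 * ?n \<and> (b < Suc j + r \<or> b = ?n) \<longleftrightarrow>
        a + 2 * b = 2 * ?n \<and> (b < j + r \<or> b = ?n) \<or>
        m \<le> a \<and> j \<le> b \<and> a + 2 * b = ?n + m + 2 * j"
    proof -
      have "?n + m + 2 * j = 2 * ?n" using m(2) by simp
      moreover have "m \<le> a \<longleftrightarrow> b \<le> j + r" if "a + 2 * b = 2 * ?n"
        using that m(2) by presburger
      moreover have "b < Suc j + r \<longleftrightarrow> b < j + r \<or> b \<le> j + r \<and> j \<le> b"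
        using assms by linarith
      ultimately show ?thesis by argo
    qed
    moreover have "a + 2 * b = 3 * ?n \<and> ?n \<le> b \<and> b < ?n + Suc j \<longleftrightarrow>
        a + 2 * b = 3 * ?n \<and> ?n \<le> b \<and> b < ?n + j \<or> a = m \<and> b = j + 2 * r + 1"
    proof -
      have "a = m \<longleftrightarrow> a + 2 * b = 3 * ?n" if "b = j + 2 * r + 1"
        using that m(2) by auto
      moreover have "b < ?n + Suc j \<longleftrightarrow> b < ?n + j \<or> b = j + 2 * r + 1" by auto
      moreover have "?n \<le> b" if "b = j + 2 * r + 1" using that by simp
      ultimately show ?thesis by argo
    qed
    moreover have "\<not> (a = m \<and> b = j)" if "a + 2 * b = 2 * ?n \<or> a + 2 * b = 3 * ?n"
      using that m(2) by auto
    ultimately show ?thesis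
      unfolding Un_iff Diff_iff singleton_iff prod.inject mem_shiftW
        mem_stair[OF j(1)] mem_stair[OF j(2)]
      by argo
  qed
  then show ?thesis unfolding m(1) by (simp add: set_eq_iff)
qed

lemma card_stair:
  assumes "j \<le> r + 1"
  shows "card (stair r j) = 2 * r + 2 + j"
proof -
  let ?n = "2 * r + 1"
  define A where "A = (\<lambda>k. (?n - 2 * k, k)) ` {j..r}"
  define B where "B = (\<lambda>i. (2 * ?n - 2 * i, i)) ` insert ?n {..<j + r}"
  define C where "C = (\<lambda>i. (?n - 2 * i, ?n + i)) ` {..<j}"
  have "a + 2 * b = ?n" if "(a, b) \<in> A" for a b using that by (auto simp: A_def)
  moreover have "a + 2 * b = 2 * ?n" if "(a, b) \<in> B" for a b using that assms by (auto simp: B_def)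
  moreover have "a + 2 * b = 3 * ?n" if "(a, b) \<in> C" for a b using that assms by (auto simp: C_def)
  ultimately have "A \<inter> B = {}" "(A \<union> B) \<inter> C = {}"
    by fastforce+
  moreover have "finite A" "finite B" "finite C" by (simp_all add: A_def B_def C_def)
  moreover have "stair r j = A \<union> B \<union> C" by (simp only: stair_def A_def B_def C_def)
  ultimately have "card (stair r j) = card A + card B + card C"
    by (simp add: card_Un_disjoint)
  also have "card A = r + 1 - j" unfolding A_def by (subst card_image) (auto simp: inj_on_def)
  also have "card B = Suc (j + r)"
    unfolding B_def using assms by (subst card_image) (auto simp: inj_on_def)
  also have "card C = j" unfolding C_def by (subst card_image) (auto simp: inj_on_def)
  finally show ?thesis using assms by simp
qed

lemma realizable_stair:
  assumes "1 \<le> j" "j \<le> r + 1"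
  shows "realizable r (stair r j)"
  using assms
proof (induction j rule: dec_induct)
  case base
  have "(2 * r + 1, 0) \<in> W r" by (simp add: mem_W)
  from realizable_tensor[OF realizable_W this] show ?case by (simp only: stair_1)
next
  case (step j)
  then have "j \<le> r" by simp
  moreover have "(2 * r + 1 - 2 * j, j) \<in> stair r j" using \<open>j \<le> r\<close> by (simp add: mem_stair)
  ultimately show ?case
    using step realizable_tensor stair_Suc by simp
qed

lemma dominant_stair:
  assumes "1 \<le> j" "j \<le> r + 1"
  shows "dominant (stair r j) (2 * (2 * r + 1))"
  unfolding dominant_def
proof (intro conjI ballI)
  show "(2 * (2 * r + 1), 0) \<in> stair r j"
    using assms by (simp add: mem_stair)
  fix p assume p: "p \<in> stair r j"
  obtain a b where ab: "p = (a, b)" by (cases p)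
  have "a = 2 * (2 * r + 1) \<and> b = 0 \<or> a < 2 * (2 * r + 1)"
    using p unfolding ab mem_stair[OF assms(2)] by (cases "b = 0") auto
  then show "case p of (a, b) \<Rightarrow> (a, b) = (2 * (2 * r + 1), 0) \<or> a < 2 * (2 * r + 1)"
    by (simp add: ab)
qed

text \<open>The stairs give \<open>r + 1\<close> consecutive counts, and tensoring at the dominant
  power adds \<open>r + 1\<close>. The exponent \<open>M\<close> is carried along so that this can
  be repeated.\<close>

lemma realizable_card:
  assumes "2 * r + 3 \<le> N"
  shows "\<exists>S M. realizable r S \<and> finite S \<and> dominant S M \<and> card S = N"
  using assms
proof (induction N rule: less_induct)
  case (less N)
  show ?case
  proof (cases "N \<le> 3 * r + 3")
    case True
    define j where "j = N - (2 * r + 2)"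
    have j: "1 \<le> j" "j \<le> r + 1" "N = 2 * r + 2 + j"
      using True less.prems by (auto simp: j_def)
    have "finite (stair r j)" by (simp add: stair_def)
    then show ?thesis
      using realizable_stair[OF j(1,2)] dominant_stair[OF j(1,2)] card_stair[OF j(2)] j(3) by metis
  next
    case False
    then have "N - (r + 1) < N" "2 * r + 3 \<le> N - (r + 1)" by auto
    from less.IH[OF this] obtain S M where S: "realizable r S" "finite S" "dominant S M"
      "card S = N - (r + 1)" by blast
    define S' where "S' = (S - {(M, 0)}) \<union> shiftW r M 0"
    have "realizable r S'"
      unfolding S'_def using S by (intro realizable_tensor) (auto simp: dominant_def)
    moreover have "finite S'" using S finite_shiftW by (simp add: S'_def)
    moreover note tensor_dominant[OF S(2,3), of r, folded S'_def]
    ultimately show ?thesis using S(4) False by (intro exI[of _ S']) auto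
  qed
qed

section \<open>Special polynomials\<close>

lemma primitive_root_power_eq_1:
  assumes "primitive_root n \<eta>" "n > 0"
  shows "\<eta> ^ k = 1 \<longleftrightarrow> n dvd k"
proof -
  have "\<eta> ^ k = \<eta> ^ (n * (k div n) + k mod n)" by simp
  also have "\<dots> = \<eta> ^ (k mod n)"
    using assms unfolding power_add power_mult primitive_root_def by simp
  finally show ?thesis
    using assms unfolding primitive_root_def
    by (metis dvd_imp_mod_0 mod_greater_zero_iff_not_dvd mod_less_divisor power_0)
qed

lemma norm_primitive_root:
  assumes "primitive_root n \<eta>" "n > 0"
  shows "norm \<eta> = 1"
  using assms norm_power[of \<eta> n] power_eq_1_iff[of "norm \<eta>" n]
  by (auto simp: primitive_root_def)

lemma eval2_of_real:
  "eval2 c (of_real x) (of_real y) = of_real (\<Sum>(a, b)\<in>supp2 c. c a b * x ^ a * y ^ b)"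
  by (simp add: eval2_def case_prod_unfold)

lemma eval2_0_0: "is_poly2 c \<Longrightarrow> eval2 c 0 0 = of_real (c 0 0)"
proof -
  assume c: "is_poly2 c"
  have "eval2 c 0 0 = (\<Sum>p\<in>supp2 c. if p = (0, 0) then of_real (c 0 0) else 0)"
    unfolding eval2_def by (intro sum.cong) (auto simp: power_0_left split: if_splits)
  then show ?thesis using c by (simp add: is_poly2_def supp2_def)
qed

lemma special2_iff_inv_poly:
  assumes \<eta>: "primitive_root (2 * r + 1) \<eta>"
  shows "special2 r \<eta> c \<longleftrightarrow> inv_poly r c"
proof
  assume s: "special2 r \<eta> c"
  then have fin: "finite (supp2 c)" and nn: "\<And>a b. 0 \<le> c a b" and p: "is_poly2 c"
    by (simp_all add: special2_def is_poly2_def)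
  have n\<eta>: "norm \<eta> = 1" using norm_primitive_root[OF \<eta>] by simp
  \<comment> \<open>Compare real parts in \<open>f(\<eta>, \<eta>\<^sup>2) = f(1, 1)\<close>: as the coefficients are non-negative,
    every monomial must attain the value \<open>1\<close>.\<close>
  have "eval2 c (\<eta> * 1) (\<eta>\<^sup>2 * 1) = eval2 c 1 1"
    using s unfolding special2_def by blast
  then have "Re (eval2 c \<eta> (\<eta>\<^sup>2)) = (\<Sum>(a, b)\<in>supp2 c. c a b)"
    using eval2_of_real[of c 1 1] by simp
  moreover have "Re (eval2 c \<eta> (\<eta>\<^sup>2)) = (\<Sum>(a, b)\<in>supp2 c. c a b * Re (\<eta> ^ (a + 2 * b)))"
    unfolding eval2_def Re_sum
    by (intro sum.cong) (auto simp: power_add power_mult mult.assoc)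
  ultimately have "(\<Sum>(a, b)\<in>supp2 c. c a b * (1 - Re (\<eta> ^ (a + 2 * b)))) = 0"
    by (simp add: right_diff_distrib sum_subtractf case_prod_unfold)
  moreover have le: "Re (\<eta> ^ k) \<le> 1" for k
    using complex_Re_le_cmod[of "\<eta> ^ k"] n\<eta> by (simp add: norm_power)
  ultimately have z: "\<forall>(a, b)\<in>supp2 c. c a b * (1 - Re (\<eta> ^ (a + 2 * b))) = 0"
    using fin nn by (subst (asm) sum_nonneg_eq_0_iff) auto
  have dvd: "2 * r + 1 dvd a + 2 * b" if "(a, b) \<in> supp2 c" for a b
  proof -
    \<comment> \<open>Norm 1 and real part 1 together force the power to be 1.\<close>
    have "Re (\<eta> ^ (a + 2 * b)) = 1"
      using z that by (auto simp: supp2_def)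
    moreover have "norm (\<eta> ^ (a + 2 * b)) = 1" by (simp add: norm_power n\<eta>)
    ultimately have "\<eta> ^ (a + 2 * b) = 1"
      by (simp add: complex_eq_iff cmod_def)
    then show ?thesis using primitive_root_power_eq_1[OF \<eta>] by simp
  qed
  have "(\<Sum>(a, b)\<in>supp2 c. c a b * x ^ a * (1 - x) ^ b) = 1" for x
  proof -
    have "\<forall>x y::real. x + y = 1 \<longrightarrow> eval2 c (of_real x) (of_real y) = 1"
      using s unfolding special2_def by blast
    from this[rule_format, of x "1 - x"]
    have "complex_of_real (\<Sum>(a, b)\<in>supp2 c. c a b * x ^ a * (1 - x) ^ b) = of_real 1"
      unfolding eval2_of_real by simp
    then show ?thesis by (simp only: of_real_eq_iff)
  qed
  moreover have "c 0 0 = 0" using s eval2_0_0[OF p] by (simp add: special2_def)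
  ultimately show "inv_poly r c" unfolding inv_poly_def using fin nn dvd by blast
next
  assume c: "inv_poly r c"
  then have p: "is_poly2 c" and nn: "\<And>a b. 0 \<le> c a b" and c0: "c 0 0 = 0"
    by (simp_all add: inv_poly_def is_poly2_def)
  have "eval2 c (\<eta> * x) (\<eta>\<^sup>2 * y) = eval2 c x y" for x y
    unfolding eval2_def
  proof (intro sum.cong refl, clarify)
    fix a b assume "(a, b) \<in> supp2 c"
    then have "2 * r + 1 dvd a + 2 * b" using c unfolding inv_poly_def by blast
    then have "\<eta> ^ a * (\<eta>\<^sup>2) ^ b = 1"
      using primitive_root_power_eq_1[OF \<eta>] by (simp flip: power_add power_mult)
    moreover have "complex_of_real (c a b) * (\<eta> * x) ^ a * (\<eta>\<^sup>2 * y) ^ b =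
        (\<eta> ^ a * (\<eta>\<^sup>2) ^ b) * (complex_of_real (c a b) * x ^ a * y ^ b)"
      by (simp add: power_mult_distrib mult_ac)
    ultimately show "complex_of_real (c a b) * (\<eta> * x) ^ a * (\<eta>\<^sup>2 * y) ^ b =
        complex_of_real (c a b) * x ^ a * y ^ b" by simp
  qed
  moreover have "eval2 c (of_real x) (of_real y) = 1" if "x + y = 1" for x y
  proof -
    have "y = 1 - x" using that by simp
    then show ?thesis using c unfolding eval2_of_real inv_poly_def by simp
  qed
  ultimately show "special2 r \<eta> c"
    unfolding special2_def using p nn c0 eval2_0_0[OF p] by simp
qed

lemma N1_special1_pos:
  assumes "special1 m \<eta> f"
  shows "1 \<le> N1 f"
proof -
  have "f \<noteq> 0" using assms by (auto simp: special1_def)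
  then have "degree f \<in> {i. coeff f i \<noteq> 0}" by simp
  moreover have "finite {i. coeff f i \<noteq> 0}"
    by (rule finite_subset[of _ "{..degree f}"]) (auto intro: le_degree)
  ultimately show ?thesis unfolding N1_def
    by (metis One_nat_def Suc_leI card_gt_0_iff empty_iff)
qed

lemma special1_exists:
  assumes "m \<ge> 1" "\<eta> ^ m = 1" "n \<ge> 1"
  shows "\<exists>f. special1 m \<eta> f \<and> N1 f = n"
proof -
  \<comment> \<open>Equal weights on \<open>x^m, ..., x^(m n)\<close>; starting at
    \<open>k = 1\<close> makes the constant term vanish.\<close>
  define f :: "real poly" where "f = (\<Sum>k\<in>{1..n}. monom (1 / n) (m * k))"
  have cf: "coeff f i = (if i \<in> (\<lambda>k. m * k) ` {1..n} then 1 / n else 0)" for i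
  proof -
    have "coeff f i = (\<Sum>k\<in>{k \<in> {1..n}. m * k = i}. 1 / n)"
      unfolding f_def coeff_sum coeff_monom
      by (intro sum.mono_neutral_cong_right) auto
    also have "\<dots> = (if i \<in> (\<lambda>k. m * k) ` {1..n} then 1 / n else 0)"
    proof (cases "i \<in> (\<lambda>k. m * k) ` {1..n}")
      case True
      then obtain k where "k \<in> {1..n}" "i = m * k" by blast
      then have "{k \<in> {1..n}. m * k = i} = {k}" using assms(1) by auto
      then show ?thesis using True by simp
    next
      case False
      then have "{k \<in> {1..n}. m * k = i} = {}" by auto
      with False show ?thesis by simp
    qed
    finally show ?thesis .
  qed
  have "map_poly complex_of_real f = (\<Sum>k\<in>{1..n}. monom (of_real (1 / n)) (m * k))"
    by (rule poly_eqI) (simp add: coeff_map_poly f_def coeff_sum coeff_monom if_distrib cong: if_cong)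
  then have "poly (map_poly complex_of_real f) (\<eta> * x) = poly (map_poly complex_of_real f) x" for x
    using assms(2) by (simp add: poly_sum poly_monom power_mult_distrib power_mult)
  moreover have "poly f 1 = 1" using assms(3) by (simp add: f_def poly_sum poly_monom)
  moreover have "poly f 0 = 0" using assms(1) by (auto simp: poly_0_coeff_0 cf)
  ultimately have "special1 m \<eta> f" by (simp add: special1_def cf)
  moreover have "{i. coeff f i \<noteq> 0} = (\<lambda>k. m * k) ` {1..n}"
    using assms(3) by (auto simp: cf)
  then have "N1 f = n"
    unfolding N1_def using assms(1) by (simp add: card_image inj_on_def)
  ultimately show ?thesis by blast
qed

theorem theorem1p2:
  shows "(\<forall>m \<eta>. m \<ge> 2 \<and> primitive_root m \<eta> \<longrightarrow>
            {N1 f | f. special1 m \<eta> f} = {n. n \<ge> 1})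
       \<and> (\<forall>r \<eta>. r \<ge> 1 \<and> primitive_root (2 * r + 1) \<eta> \<longrightarrow>
            {N2 c | c. special2 r \<eta> c} = {r + 2} \<union> {n. n \<ge> 2 * r + 3})"
proof (intro conjI allI impI)
  fix m :: nat and \<eta> :: complex
  assume "m \<ge> 2 \<and> primitive_root m \<eta>"
  then have "m \<ge> 1" "\<eta> ^ m = 1" by (simp_all add: primitive_root_def)
  then show "{N1 f | f. special1 m \<eta> f} = {n. n \<ge> 1}"
    using N1_special1_pos special1_exists by blast
next
  fix r :: nat and \<eta> :: complex
  assume "r \<ge> 1 \<and> primitive_root (2 * r + 1) \<eta>"
  then have iff: "special2 r \<eta> c \<longleftrightarrow> inv_poly r c" for c
    by (intro special2_iff_inv_poly) simp
  show "{N2 c | c. special2 r \<eta> c} = {r + 2} \<union> {n. n \<ge> 2 * r + 3}"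
  proof (intro equalityI subsetI)
    fix N assume "N \<in> {N2 c | c. special2 r \<eta> c}"
    then show "N \<in> {r + 2} \<union> {n. n \<ge> 2 * r + 3}"
      using card_supp2_dichotomy by (auto simp: iff N2_def)
  next
    fix N assume "N \<in> {r + 2} \<union> {n. n \<ge> 2 * r + 3}"
    then have "\<exists>S. realizable r S \<and> card S = N"
      using realizable_W card_W realizable_card by blast
    then show "N \<in> {N2 c | c. special2 r \<eta> c}"
      by (auto simp: realizable_def iff N2_def)
  qed
qed

end
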